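(* There is no positive integer $n$ for which there exist integers $\{a_d : d \mid n,\ d>1\}$ such that the congruence set $\{a_d \bmod d : d\mid n,\ d>1\}$ is a covering system and, for all distinct divisors $d\neq d'$ of $n$ greater than $1$, the congruences $a_d \bmod d$ and $a_{d'} \bmod d'$ overlap only if $\gcd(d,d')=1$.
   Context: A set of congruences $\{a_1 \bmod d_1,\ldots,a_t \bmod d_t\}$ is a covering system if every integer $x$ satisfies $x\equiv a_i \pmod{d_i}$ for some $1\le i\le t$. Two congruences $a\bmod d$ and $a'\bmod d'$ overlap if some integer satisfies both. *)

theory Defs
  imports Complex_Main "HOL-Number_Theory.Cong"
begin

text \<open>A congruence \<open>a mod d\<close> is represented by the pair \<open>(a, d)\<close>.\<close>

definition covering_system :: "(int \<times> nat) set \<Rightarrow> bool" where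
  "covering_system C \<longleftrightarrow>
     finite C \<and> (\<forall>(a, d)\<in>C. d > 0) \<and> (\<forall>x::int. \<exists>(a, d)\<in>C. [x = a] (mod int d))"

definition overlap :: "int \<times> nat \<Rightarrow> int \<times> nat \<Rightarrow> bool" where
  "overlap = (\<lambda>(a, d) (a', d'). \<exists>x::int. [x = a] (mod int d) \<and> [x = a'] (mod int d'))"

end

theory Submission
  imports Defs
begin

text \<open>Let \<open>n\<close> have \<open>r\<close> prime factors and let \<open>p\<close> be one of them. The classes with moduli \<open>p\<close>,
  \<open>p * q\<close> for the other primes \<open>q\<close>, and \<open>p\<^sup>2\<close> if it divides \<open>n\<close>, are pairwise disjoint, which
  forces their residues modulo \<open>p\<close> to be distinct. Hence \<open>r \<le> p\<close>, and \<open>r < p\<close> if \<open>p\<^sup>2\<close> divides \<open>n\<close>.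
  So the Euler factor of \<open>p\<close> in the sum of \<open>1/d\<close> over the divisors of \<open>n\<close> is at most \<open>1 + 1/b\<close> with
  \<open>b = p - 1\<close> if \<open>p > r\<close> and \<open>b = r\<close> if \<open>p = r\<close>. Unless the primes are 2 and 3, these are \<open>r\<close>
  distinct numbers \<open>b \<ge> r\<close>, and the sum is less than the telescoping product
  \<open>(r+1)/r \<cdot> (r+2)/(r+1) \<cdots> 2r/(2r-1) = 2\<close>. The divisors greater than 1 then contribute less
  than 1, too little to cover the integers.\<close>

section \<open>Overlap and density of residue classes\<close>

lemma overlap_iff_cong_gcd:
  "overlap (a, d) (a', d') \<longleftrightarrow> [a = a'] (mod int (gcd d d'))"
proof
  assume "overlap (a, d) (a', d')"
  then obtain x where "[x = a] (mod int d)" "[x = a'] (mod int d')"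
    by (auto simp: overlap_def)
  then have "[x = a] (mod int (gcd d d'))" "[x = a'] (mod int (gcd d d'))"
    by (auto intro: cong_dvd_modulus)
  then show "[a = a'] (mod int (gcd d d'))"
    using cong_sym cong_trans by blast
next
  assume "[a = a'] (mod int (gcd d d'))"
  then have "gcd (int d) (int d') dvd a' - a"
    by (simp add: cong_iff_dvd_diff dvd_diff_commute)
  then obtain t where t: "a' - a = gcd (int d) (int d') * t" ..
  obtain u v where uv: "u * int d + v * int d' = gcd (int d) (int d')"
    using bezout_int by blast
  \<comment> \<open>By Bezout, \<open>a' - a = d * u * t + d' * v * t\<close>; adding only the first
    summand to \<open>a\<close> keeps the class modulo \<open>d\<close> and reaches that of
    \<open>a'\<close> modulo \<open>d'\<close>.\<close>
  have "[a + int d * (u * t) = a] (mod int d)"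
    by (simp add: cong_iff_dvd_diff)
  moreover have "a + int d * (u * t) - a' = int d' * (- v * t)"
    using t unfolding uv [symmetric] by (simp add: algebra_simps)
  then have "[a + int d * (u * t) = a'] (mod int d')"
    unfolding cong_iff_dvd_diff by (metis dvd_triv_left)
  ultimately show "overlap (a, d) (a', d')"
    by (auto simp: overlap_def)
qed

lemma card_residue_class_le:
  fixes c :: int and m t :: nat
  assumes "m > 0"
  shows "card {x \<in> {0..<int (m * t)}. [x = c] (mod int m)} \<le> t"
proof -
  have "{x \<in> {0..<int (m * t)}. [x = c] (mod int m)} \<subseteq> (\<lambda>j. c mod int m + int m * j) ` {0..<int t}"
  proof
    fix x assume "x \<in> {x \<in> {0..<int (m * t)}. [x = c] (mod int m)}"
    then have x: "0 \<le> x" "x < int t * int m" "x mod int m = c mod int m"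
      by (auto simp: cong_def mult.commute)
    have "x = c mod int m + int m * (x div int m)"
      using x(3) by (metis mod_mult_div_eq)
    moreover have "x div int m * int m < int t * int m"
      using x(2) assms minus_mod_eq_div_mult[of x "int m"] pos_mod_sign[of "int m" x] by linarith
    then have "x div int m \<in> {0..<int t}"
      using x(1) assms by (simp add: pos_imp_zdiv_nonneg_iff)
    ultimately show "x \<in> (\<lambda>j. c mod int m + int m * j) ` {0..<int t}"
      by blast
  qed
  then have "card {x \<in> {0..<int (m * t)}. [x = c] (mod int m)}
      \<le> card ((\<lambda>j. c mod int m + int m * j) ` {0..<int t})"
    by (intro card_mono) auto
  also have "\<dots> \<le> t"
    using card_image_le[of "{0..<int t}"] by fastforce
  finally show ?thesis .
qed

text \<open>Union bound over one common period \<open>N\<close>, the product of the moduli: class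
  \<open>i\<close> has at most \<open>N / m i\<close> elements there. The classes form an indexed
  family so that a modulus may occur more than once, as happens for
  \<open>n = 2 * 3 ^ k\<close>.\<close>

lemma covering_sum_inverse_ge_1:
  fixes c :: "'i \<Rightarrow> int" and m :: "'i \<Rightarrow> nat"
  assumes I: "finite I" and m: "\<And>i. i \<in> I \<Longrightarrow> m i > 0"
    and cover: "\<And>x. \<exists>i\<in>I. [x = c i] (mod int (m i))"
  shows "1 \<le> (\<Sum>i\<in>I. 1 / real (m i))"
proof -
  define N where "N = prod m I"
  have N: "N > 0" unfolding N_def using m by (intro prod_pos) auto
  define A where "A i = {x \<in> {0..<int N}. [x = c i] (mod int (m i))}" for i
  have card_A: "real (card (A i)) \<le> real N * (1 / real (m i))" if i: "i \<in> I" for i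
  proof -
    have "m i dvd N" unfolding N_def using I i by (rule dvd_prodI)
    then obtain t where t: "N = m i * t" ..
    then have "card (A i) \<le> t"
      unfolding A_def t by (intro card_residue_class_le m i)
    then show ?thesis using m[OF i] t by simp
  qed
  have "{0..<int N} \<subseteq> (\<Union>i\<in>I. A i)"
    using cover by (auto simp: A_def)
  moreover have "finite (A i)" for i
    by (rule finite_subset[of _ "{0..<int N}"]) (auto simp: A_def)
  ultimately have "N \<le> card (\<Union>i\<in>I. A i)"
    using card_mono[of "\<Union>i\<in>I. A i" "{0..<int N}"] I by simp
  also have "\<dots> \<le> (\<Sum>i\<in>I. card (A i))"
    using I by (rule card_UN_le)
  finally have "real N \<le> (\<Sum>i\<in>I. real (card (A i)))"
    by (metis of_nat_le_iff of_nat_sum)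
  also have "\<dots> \<le> (\<Sum>i\<in>I. real N * (1 / real (m i)))"
    by (intro sum_mono card_A)
  finally have "real N * 1 \<le> real N * (\<Sum>i\<in>I. 1 / real (m i))"
    by (simp add: sum_distrib_left)
  then show ?thesis using N by (simp only: mult_le_cancel_left_pos of_nat_0_less_iff)
qed

section \<open>Euler factors and the sum of reciprocals of divisors\<close>

lemma sum_inverse_powers_less:
  fixes p :: nat
  assumes "p > 1"
  shows "(\<Sum>i\<le>k. 1 / real (p ^ i)) < 1 + 1 / real (p - 1)"
proof -
  \<comment> \<open>The full geometric series has sum \<open>p / (p - 1) = 1 + 1 / (p - 1)\<close>;
    a finite part stays strictly below it.\<close>
  have "(1 - 1 / real p) * (\<Sum>i\<le>k. (1 / real p) ^ i) = 1 - (1 / real p) ^ Suc k"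
    by (rule sum_gp_basic)
  also have "\<dots> < 1" using assms by simp
  finally show ?thesis
    using assms by (simp add: power_one_over of_nat_diff field_simps)
qed

text \<open>The worst case is \<open>B = {m..<m + card B}\<close>, where the product telescopes. The
  induction removes the largest element.\<close>

lemma prod_one_plus_inverse_le:
  assumes "finite B" "m > 0" "\<And>b. b \<in> B \<Longrightarrow> m \<le> b"
  shows "(\<Prod>b\<in>B. 1 + 1 / real b) \<le> real (m + card B) / real m"
  using assms
proof (induction "card B" arbitrary: B)
  case 0
  then show ?case by auto
next
  case (Suc k)
  define M where "M = Max B"
  have M: "M \<in> B" unfolding M_def using Suc by (intro Max_in) auto
  \<comment> \<open>The \<open>k + 1\<close> elements of \<open>B\<close> fit between
    \<open>m\<close> and \<open>M\<close>, which forces \<open>M \<ge> m + k\<close>.\<close>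
  have "B \<subseteq> {m..M}" using Suc by (auto simp: M_def)
  then have "card B \<le> card {m..M}" by (intro card_mono) auto
  then have "M \<ge> m + k" using Suc by auto
  have k: "card (B - {M}) = k" using Suc M by simp
  have "(\<Prod>b\<in>B. 1 + 1 / real b) = (1 + 1 / real M) * (\<Prod>b\<in>B - {M}. 1 + 1 / real b)"
    using Suc M by (simp add: prod.remove)
  also have "\<dots> \<le> (1 + 1 / real (m + k)) * (real (m + card (B - {M})) / real m)"
  proof (intro mult_mono)
    show "(\<Prod>b\<in>B - {M}. 1 + 1 / real b) \<le> real (m + card (B - {M})) / real m"
      using Suc k by (intro Suc.hyps) auto
    show "1 + 1 / real M \<le> 1 + 1 / real (m + k)"
      using \<open>M \<ge> m + k\<close> Suc.prems by (simp add: frac_le)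
  qed (auto intro!: prod_nonneg)
  also have "\<dots> = real (m + card B) / real m"
    using Suc.prems by (simp add: k divide_simps flip: Suc.hyps(2))
  finally show ?case .
qed

lemma sum_divisors_inverse_le:
  fixes n :: nat
  assumes "n > 0"
  shows "(\<Sum>d | d dvd n. 1 / real d)
    \<le> (\<Prod>p\<in>prime_factors n. \<Sum>i\<le>multiplicity p n. 1 / real (p ^ i))"
  using assms
proof (induction n rule: less_induct)
  case (less n)
  show ?case
  proof (cases "n = 1")
    case True
    then show ?thesis by simp
  next
    case False
    then obtain p where p: "prime p" "p dvd n"
      using prime_factor_nat by blast
    define k where "k = multiplicity p n"
    obtain m where m: "n = p ^ k * m" "\<not> p dvd m"
      unfolding k_def using less.prems p by (metis multiplicity_decompose' not_prime_unit less_irrefl)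
    have "m > 0" using m less.prems by (cases m) auto
    have "k > 0" using p less.prems by (simp add: k_def prime_multiplicity_gt_zero_iff)
    have "p ^ k > 1" using \<open>k > 0\<close> p by (intro one_less_power prime_gt_1_nat)
    then have "m < n" using m \<open>m > 0\<close> by simp
    have cop: "coprime (p ^ k) m" using m p by (simp add: prime_imp_coprime)
    have factors: "prime_factors n = insert p (prime_factors m)"
      using m p \<open>m > 0\<close> \<open>k > 0\<close> by (simp add: prime_factors_product prime_factorization_prime_power)
    have notin: "p \<notin> prime_factors m" using m by (auto simp: in_prime_factors_iff)
    have mult: "multiplicity q n = multiplicity q m" if "q \<in> prime_factors m" for q
    proof -
      have "prime q" "q \<noteq> p" using that notin by (auto simp: in_prime_factors_iff)
      then show ?thesis
        using m p \<open>m > 0\<close> by (simp add: prime_elem_multiplicity_mult_distrib multiplicity_distinct_prime_power)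
    qed
    \<comment> \<open>Every divisor of \<open>n\<close> splits into a power of \<open>p\<close> and
      a divisor of \<open>m\<close>, so the sum is bounded by a product of two sums, the second
      treated by induction.\<close>
    have "{d. d dvd n} \<subseteq> (\<lambda>(i, e). p ^ i * e) ` ({..k} \<times> {e. e dvd m})"
    proof
      fix d assume "d \<in> {d. d dvd n}"
      then obtain b e where "d = b * e" "b dvd p ^ k" "e dvd m"
        using m division_decomp by blast
      then show "d \<in> (\<lambda>(i, e). p ^ i * e) ` ({..k} \<times> {e. e dvd m})"
        using p by (auto simp: divides_primepow_nat image_iff)
    qed
    then have "(\<Sum>d | d dvd n. 1 / real d)
        \<le> (\<Sum>d\<in>(\<lambda>(i, e). p ^ i * e) ` ({..k} \<times> {e. e dvd m}). 1 / real d)"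
      using \<open>m > 0\<close> by (intro sum_mono2) auto
    also have "\<dots> \<le> (\<Sum>(i, e)\<in>{..k} \<times> {e. e dvd m}. 1 / real (p ^ i * e))"
      using \<open>m > 0\<close> sum_image_le[of "{..k} \<times> {e. e dvd m}" "\<lambda>d. 1 / real d" "\<lambda>(i, e). p ^ i * e"]
      by (auto simp: case_prod_unfold o_def)
    also have "\<dots> = (\<Sum>i\<le>k. 1 / real (p ^ i)) * (\<Sum>e | e dvd m. 1 / real e)"
      by (simp add: sum_product sum.cartesian_product)
    also have "\<dots> \<le> (\<Sum>i\<le>k. 1 / real (p ^ i)) *
        (\<Prod>q\<in>prime_factors m. \<Sum>i\<le>multiplicity q m. 1 / real (q ^ i))"
      using less.IH[OF \<open>m < n\<close> \<open>m > 0\<close>] by (intro mult_left_mono) (auto intro: sum_nonneg)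
    also have "\<dots> = (\<Prod>q\<in>prime_factors n. \<Sum>i\<le>multiplicity q n. 1 / real (q ^ i))"
      using notin mult by (simp add: factors k_def)
    finally show ?thesis .
  qed
qed

section \<open>Prime factors of a hypothetical counterexample\<close>

locale coprime_overlap =
  fixes n :: nat and a :: "nat \<Rightarrow> int"
  assumes n_pos: "n > 0"
    and cover: "\<And>x. \<exists>d. d dvd n \<and> d > 1 \<and> [x = a d] (mod int d)"
    and overlap_coprime: "\<And>d d'. d dvd n \<Longrightarrow> d > 1 \<Longrightarrow> d' dvd n \<Longrightarrow> d' > 1 \<Longrightarrow> d \<noteq> d' \<Longrightarrow>
      overlap (a d, d) (a d', d') \<Longrightarrow> gcd d d' = 1"
begin

text \<open>The moduli \<open>p * s\<close> have pairwise gcd \<open>p\<close>, so their residues modulo \<open>p\<close> are distinct.\<close>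

lemma card_pairwise_coprime_le:
  assumes "p > 1" "finite S"
    and dvd: "\<And>s. s \<in> S \<Longrightarrow> p * s dvd n"
    and coprime: "\<And>s t. s \<in> S \<Longrightarrow> t \<in> S \<Longrightarrow> s \<noteq> t \<Longrightarrow> coprime s t"
  shows "card S \<le> p"
proof -
  have "inj_on (\<lambda>s. a (p * s) mod int p) S"
  proof (rule inj_onI, rule ccontr)
    fix s t assume st: "s \<in> S" "t \<in> S" "a (p * s) mod int p = a (p * t) mod int p" "s \<noteq> t"
    have gcd: "gcd (p * s) (p * t) = p"
      using coprime[OF st(1,2,4)] by (simp add: gcd_mult_distrib_nat[symmetric])
    have gt: "p * u > 1" if "u \<in> S" for u
      using dvd[OF that] n_pos \<open>p > 1\<close> by (cases u) auto
    have "overlap (a (p * s), p * s) (a (p * t), p * t)"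
      using st(3) by (simp add: overlap_iff_cong_gcd gcd cong_def)
    then have "gcd (p * s) (p * t) = 1"
      using st dvd gt \<open>p > 1\<close> by (intro overlap_coprime) auto
    then show False using gcd \<open>p > 1\<close> by simp
  qed
  moreover have "(\<lambda>s. a (p * s) mod int p) ` S \<subseteq> {0..<int p}"
    using \<open>p > 1\<close> by auto
  ultimately have "card S \<le> card {0..<int p}"
    by (intro card_inj_on_le) auto
  then show ?thesis by simp
qed

lemma card_prime_factors_le:
  assumes "p \<in> prime_factors n"
  shows "card (prime_factors n) \<le> p"
proof -
  have p: "prime p" "p dvd n" using assms by auto
  have not_one: "1 \<notin> prime_factors n" using in_prime_factors_imp_prime not_prime_1 by blast
  \<comment> \<open>The cofactor \<open>1\<close> yields the modulus \<open>p\<close> itself and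
    takes the place of \<open>p\<close>, so the size is still the number of primes.\<close>
  have "card (insert 1 (prime_factors n - {p})) \<le> p"
  proof (rule card_pairwise_coprime_le)
    show "p * s dvd n" if "s \<in> insert 1 (prime_factors n - {p})" for s
      using that p by (cases "s = 1") (auto intro!: divides_mult primes_coprime)
    show "coprime s t" if "s \<in> insert 1 (prime_factors n - {p})"
      "t \<in> insert 1 (prime_factors n - {p})" "s \<noteq> t" for s t
      using that by (auto intro: primes_coprime)
  qed (use p prime_gt_1_nat[OF p(1)] in auto)
  moreover have "card (insert 1 (prime_factors n - {p})) = card (prime_factors n)"
    using not_one card.remove[OF _ assms] by simp
  ultimately show ?thesis by simp
qed

lemma card_prime_factors_less:
  assumes "p \<in> prime_factors n" "p ^ 2 dvd n"
  shows "card (prime_factors n) < p"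
proof -
  have p: "prime p" "p dvd n" using assms by auto
  have not_one: "1 \<notin> prime_factors n" using in_prime_factors_imp_prime not_prime_1 by blast
  \<comment> \<open>Now \<open>p\<close> is also an admissible cofactor, with modulus
    \<open>p ^ 2\<close>; this extra element makes the bound strict.\<close>
  have "card (insert 1 (prime_factors n)) \<le> p"
  proof (rule card_pairwise_coprime_le)
    show "p * s dvd n" if "s \<in> insert 1 (prime_factors n)" for s
      using that p assms(2)
      by (cases "s = 1"; cases "s = p")
        (auto simp: power2_eq_square intro!: divides_mult primes_coprime)
    show "coprime s t" if "s \<in> insert 1 (prime_factors n)"
      "t \<in> insert 1 (prime_factors n)" "s \<noteq> t" for s t
      using that by (auto intro: primes_coprime)
  qed (use p prime_gt_1_nat[OF p(1)] in auto)
  moreover have "card (insert 1 (prime_factors n)) = Suc (card (prime_factors n))"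
    using not_one by simp
  ultimately show ?thesis by simp
qed

text \<open>The divisor 1 contributes 1, and the covering moduli contribute at least 1 by the union
  bound.\<close>

lemma sum_divisors_inverse_ge_2: "(\<Sum>d | d dvd n. 1 / real d) \<ge> 2"
proof -
  have fin: "finite {d. d dvd n}" using n_pos by simp
  have "1 \<le> (\<Sum>d\<in>{d. d dvd n} - {1}. 1 / real d)"
  proof (rule covering_sum_inverse_ge_1)
    show "\<exists>d\<in>{d. d dvd n} - {1}. [x = a d] (mod int d)" for x
      using cover[of x] by auto
  qed (use fin n_pos in \<open>auto intro: dvd_pos_nat\<close>)
  then show ?thesis
    using fin by (simp add: sum.remove[of _ 1])
qed

lemma prime_factors_eq_2_3: "prime_factors n = {2, 3}"
proof (rule ccontr)
  assume neq: "prime_factors n \<noteq> {2, 3}"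
  define P where "P = prime_factors n"
  define r where "r = card P"
  define b where "b p = (if p = r then r else p - 1)" for p
  define f where "f p = (\<Sum>i\<le>multiplicity p n. 1 / real (p ^ i))" for p
  have fin: "finite P" by (simp add: P_def)
  have prime: "prime p" and r_le: "r \<le> p" if "p \<in> P" for p
    using that card_prime_factors_le by (auto simp: P_def r_def)
  have "n \<noteq> 1" using sum_divisors_inverse_ge_2 by auto
  then have "P \<noteq> {}" using n_pos by (simp add: P_def prime_factorization_empty_iff)
  then have "r > 0" using fin by (simp add: r_def card_gt_0_iff)
  have b_ge: "r \<le> b p" if "p \<in> P" for p
    using r_le[OF that] by (auto simp: b_def)
  have f_less: "f p < 1 + 1 / real (b p)" if "p \<in> P" "p \<noteq> r" for p
    using sum_inverse_powers_less[OF prime_gt_1_nat[OF prime[OF that(1)]]] that(2)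
    by (simp add: f_def b_def)
  \<comment> \<open>If \<open>p = r\<close>, then \<open>p ^ 2\<close> cannot divide
    \<open>n\<close>, and the factor is exactly \<open>1 + 1 / r\<close>.\<close>
  have f_le: "f p \<le> 1 + 1 / real (b p)" if p: "p \<in> P" for p
  proof (cases "p = r")
    case True
    have "\<not> p ^ 2 dvd n"
      using card_prime_factors_less[of p] p True by (auto simp: P_def r_def)
    then have "multiplicity p n < 2"
      using n_pos prime[OF p] multiplicity_dvd' by (metis not_le)
    moreover have "multiplicity p n > 0"
      using p n_pos by (auto simp: P_def prime_factors_multiplicity)
    ultimately have "multiplicity p n = 1" by simp
    then show ?thesis using True by (simp add: f_def b_def)
  qed (use f_less[OF p] in simp)
  have inj: "inj_on b P"
  proof (rule inj_onI, rule ccontr)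
    \<comment> \<open>\<open>b\<close> can collide only at \<open>r\<close> and
      \<open>r + 1\<close>. If both are primes in \<open>P\<close>, one of them is even, so
      \<open>r = 2\<close>, and the two elements of \<open>P\<close> are 2 and 3.\<close>
    have *: False if "r \<in> P" "Suc r \<in> P"
    proof -
      have "even r \<or> even (Suc r)" by auto
      then have "r = 2"
        using prime[OF that(1)] prime[OF that(2)]
        by (metis One_nat_def Suc_1 not_prime_1 prime_nat_iff even_Suc nat.inject two_is_prime_nat primes_dvd_imp_eq)
      then have "P = {2, 3}"
        using that fin by (intro card_seteq[symmetric]) (auto simp: r_def)
      then show False using neq by (simp add: P_def)
    qed
    fix p q assume "p \<in> P" "q \<in> P" "b p = b q" "p \<noteq> q"
    then show False
      using * prime_gt_0_nat[OF prime[of p]] prime_gt_0_nat[OF prime[of q]]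
      by (auto simp: b_def split: if_splits)
  qed
  \<comment> \<open>A prime other than \<open>r\<close> has a strict bound, which makes the whole
    product estimate strict.\<close>
  obtain p where p: "p \<in> P" "p \<noteq> r"
  proof (cases "r = 1")
    case True
    then show ?thesis using that \<open>P \<noteq> {}\<close> prime by fastforce
  next
    case False
    then have "\<not> P \<subseteq> {r}" using \<open>r > 0\<close> card_mono[of "{r}" P] by (auto simp: r_def)
    then show ?thesis using that by auto
  qed
  have "(\<Sum>d | d dvd n. 1 / real d) \<le> (\<Prod>p\<in>P. f p)"
    unfolding P_def f_def using n_pos by (rule sum_divisors_inverse_le)
  also have "\<dots> = f p * (\<Prod>p\<in>P - {p}. f p)"
    using fin p by (simp add: prod.remove)
  also have "\<dots> < (1 + 1 / real (b p)) * (\<Prod>p\<in>P - {p}. 1 + 1 / real (b p))"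
  proof (rule mult_less_le_imp_less)
    have pos: "f q > 0" if "q \<in> P" for q
      using prime_gt_0_nat[OF prime[OF that]] unfolding f_def by (intro sum_pos) auto
    show "0 \<le> f p" using pos p by (simp add: less_imp_le)
    show "0 < (\<Prod>p\<in>P - {p}. f p)" using pos by (intro prod_pos) auto
    show "(\<Prod>p\<in>P - {p}. f p) \<le> (\<Prod>p\<in>P - {p}. 1 + 1 / real (b p))"
      using pos f_le by (intro prod_mono) (auto simp: less_imp_le)
  qed (rule f_less[OF p])
  also have "\<dots> = (\<Prod>p\<in>P. 1 + 1 / real (b p))"
    using fin p by (simp add: prod.remove)
  also have "\<dots> = (\<Prod>x\<in>b ` P. 1 + 1 / real x)"
    using inj by (simp add: prod.reindex)
  also have "\<dots> \<le> real (r + card (b ` P)) / real r"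
    using fin \<open>r > 0\<close> b_ge by (intro prod_one_plus_inverse_le) auto
  also have "\<dots> = 2"
    using inj \<open>r > 0\<close> by (simp add: card_image r_def)
  finally show False using sum_divisors_inverse_ge_2 by simp
qed

section \<open>The exceptional case of the primes 2 and 3\<close>

text \<open>The union bound is too weak for \<open>n = 2 * 3 ^ k\<close>; it works inside the residue class
  modulo 2 that is missed by \<open>a 2\<close>.\<close>

lemma no_coprime_overlap: False
proof -
  define k where "k = multiplicity 3 n"
  have "\<not> 2 ^ 2 dvd n"
    using card_prime_factors_less[of 2] prime_factors_eq_2_3 by auto
  then have "multiplicity 2 n < 2"
    using multiplicity_dvd' by (metis not_le)
  moreover have "multiplicity 2 n > 0"
    using prime_factors_eq_2_3 by (auto simp: prime_factors_multiplicity)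
  ultimately have "multiplicity 2 n = 1" by simp
  then have n: "n = 2 * 3 ^ k"
    using prime_factorization_nat[OF n_pos] prime_factors_eq_2_3 by (simp add: k_def)
  have "\<exists>u::int. [2 * u = 1] (mod 3 ^ i)" for i
    by (intro cong_solve_coprime_int) simp
  then obtain u :: "nat \<Rightarrow> int" where u: "\<And>i. [2 * u i = 1] (mod 3 ^ i)"
    by metis
  \<comment> \<open>Points of the missed class are \<open>a 2 + 1 + 2 * y\<close>. Since
    \<open>u i\<close> inverts 2 modulo \<open>3 ^ i\<close>, the congruence with modulus
    \<open>j * 3 ^ i\<close> forces \<open>y\<close> into the class of \<open>c (i, j)\<close>
    modulo \<open>3 ^ i\<close>.\<close>
  define c where "c = (\<lambda>(i, j). u i * (a (j * 3 ^ i) - a 2 - 1))"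
  \<comment> \<open>Both \<open>3 ^ i\<close> and \<open>2 * 3 ^ i\<close> act on \<open>y\<close>
    with modulus \<open>3 ^ i\<close>. The exponent \<open>i = 0\<close> drops out: it would give
    the modulus 1 or 2.\<close>
  have "1 \<le> (\<Sum>x\<in>{1..k} \<times> {1, 2 :: nat}. 1 / real (3 ^ fst x))"
  proof (rule covering_sum_inverse_ge_1)
    fix y :: int
    obtain d where d: "d dvd n" "d > 1" "[a 2 + 1 + 2 * y = a d] (mod int d)"
      using cover by blast
    have "d \<noteq> 2"
    proof
      assume "d = 2"
      then have "[a 2 + 1 + 2 * y = a 2] (mod 2)" using d(3) by simp
      then show False by (simp add: cong_iff_dvd_diff)
    qed
    obtain j e where je: "d = j * e" "j dvd 2" "e dvd 3 ^ k"
      using d(1) n division_decomp by blast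
    then have j: "j = 1 \<or> j = 2" using prime_nat_iff two_is_prime_nat by blast
    obtain i where i: "e = 3 ^ i" "i \<le> k"
      using je(3) divides_primepow_nat[of 3 e k] by auto
    have "i \<noteq> 0" using i j je d(2) \<open>d \<noteq> 2\<close> by (intro notI) auto
    have "[a 2 + 1 + 2 * y = a d] (mod 3 ^ i)"
      using d(3) by (rule cong_dvd_modulus) (simp add: je i)
    then have "[2 * y = a d - a 2 - 1] (mod 3 ^ i)"
      by (simp add: cong_iff_dvd_diff algebra_simps)
    then have "[u i * (2 * y) = c (i, j)] (mod 3 ^ i)"
      by (simp add: c_def je i cong_scalar_left)
    moreover have "[u i * (2 * y) = y] (mod 3 ^ i)"
      using cong_scalar_right[OF u, of i y] by (simp add: mult_ac)
    ultimately have "[y = c (i, j)] (mod 3 ^ i)"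
      using cong_sym cong_trans by blast
    then show "\<exists>x\<in>{1..k} \<times> {1, 2}. [y = c x] (mod int (3 ^ fst x))"
      using i j \<open>i \<noteq> 0\<close> by (intro bexI[of _ "(i, j)"]) auto
  qed auto
  also have "\<dots> = 2 * (\<Sum>i = 1..k. 1 / real (3 ^ i))"
    by (simp add: sum.cartesian_product' sum_distrib_left)
  also have "(\<Sum>i = 1..k. 1 / real (3 ^ i)) = (\<Sum>i\<le>k. 1 / real (3 ^ i)) - 1"
    by (simp add: atMost_atLeast0 sum.atLeast_Suc_atMost)
  \<comment> \<open>The powers \<open>1 / 3 ^ i\<close> with \<open>i \<ge> 1\<close> sum to less
    than 1/2, so even taken twice they stay below 1.\<close>
  also have "2 * \<dots> < 2 * (1 / real (3 - 1))"
    using sum_inverse_powers_less[of 3 k] by simp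
  finally show False by simp
qed

end

theorem theorem1:
  shows "\<not> (\<exists>n::nat. n > 0 \<and>
           (\<exists>a :: nat \<Rightarrow> int.
              covering_system {(a d, d) | d. d dvd n \<and> d > 1} \<and>
              (\<forall>d d'. d dvd n \<and> d > 1 \<and> d' dvd n \<and> d' > 1 \<and> d \<noteq> d' \<longrightarrow>
                 overlap (a d, d) (a d', d') \<longrightarrow> gcd d d' = 1)))"
proof (rule notI, elim exE conjE)
  fix n :: nat and a :: "nat \<Rightarrow> int"
  assume n: "n > 0"
    and cov: "covering_system {(a d, d) | d. d dvd n \<and> d > 1}"
    and ov: "\<forall>d d'. d dvd n \<and> d > 1 \<and> d' dvd n \<and> d' > 1 \<and> d \<noteq> d' \<longrightarrow>
      overlap (a d, d) (a d', d') \<longrightarrow> gcd d d' = 1"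
  interpret coprime_overlap n a
  proof
    show "\<exists>d. d dvd n \<and> d > 1 \<and> [x = a d] (mod int d)" for x
      using cov unfolding covering_system_def by blast
  qed (use n ov in blast)+
  show False by (rule no_coprime_overlap)
qed

end
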